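(* Consider the strapdown inertial navigation system in quaternion form $$\dot{\mathbf q}=\tfrac12\,\Omega\,\mathbf q,\qquad \dot{\mathbf v}=\mathbf A(\mathbf q)\,\gamma,\qquad \dot{\mathbf r}=\mathbf v ,$$ where $\mathbf q=(q_0,q_1,q_2,q_3)^T$ is the quaternion vector describing angular position, $\mathbf v\in\mathbb R^3$ is the inertial velocity, $\mathbf r\in\mathbb R^3$ is the inertial position, the body turn rate $\omega(t)\in\mathbb R^3$ and the acceleration $\gamma(t)\in\mathbb R^3$ are measured continuously in time in body-fixed coordinates, and $\Omega$ (built from $\omega$) and $\mathbf A(\mathbf q)$ are the matrices defined in the context. Suppose that $\mathbf q_i=\mathbf q(t_i)$ and $\mathbf r_i=\mathbf r(t_i)$ are measured at a series of instants $\{t_i\}$, and let $\Delta t_i=t_{i+1}-t_i$. Consider the observer $(\hat{\mathbf q},\hat{\mathbf v},\hat{\mathbf r})$ which evolves between measurements according to $$\dot{\hat{\mathbf q}}=\tfrac12\,\Omega\,\hat{\mathbf q},\qquad \dot{\hat{\mathbf v}}=\mathbf A(\hat{\mathbf q})\,\gamma,\qquad \dot{\hat{\mathbf r}}=\hat{\mathbf v},$$ and is updated at the measurement instants by $$\hat{\mathbf q}_i^+=\mathbf F_{1i}\,\hat{\mathbf q}_i^-+(\mathbf I-\mathbf F_{1i})\,\mathbf q_i,$$ $$\hat{\mathbf v}_{i+1}^+=\hat{\mathbf v}_{i+1}^- -\frac1{\Delta t_i}\int_{t_i}^{t_{i+1}}\hat{\mathbf v}\,dt+\frac1{\Delta t_i}(\mathbf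 r_{i+1}-\mathbf r_i),$$ $$\hat{\mathbf r}_i^+=\mathbf F_{3i}\,\hat{\mathbf r}_i^-+(\mathbf I-\mathbf F_{3i})\,\mathbf r_i ,$$ where $\mathbf F_{1i}\in\mathbb R^{4\times4}$ and $\mathbf F_{3i}\in\mathbb R^{3\times3}$ are gain matrices. If the largest eigenvalue of $\mathbf F_{1i}^T\mathbf F_{1i}$ and the largest eigenvalue of $\mathbf F_{3i}^T\mathbf F_{3i}$ are both uniformly less than $1$ (that is, at most some $\alpha<1$ for all $i$), then $\hat{\mathbf q}$ tends to $\mathbf q$, $\hat{\mathbf v}$ tends to $\mathbf v$, and $\hat{\mathbf r}$ tends to $\mathbf r$, exponentially.
   Context: Superscripts $-$ and $+$ with subscript $i$ denote the values of an estimate immediately before and immediately after the discrete update at time $t_i$. With $\omega=(\omega_1,\omega_2,\omega_3)^T$, $$\Omega=\begin{bmatrix}0&-\omega_1&-\omega_2&-\omega_3\\ \omega_1&0&-\omega_3&\omega_2\\ \omega_2&\omega_3&0&-\omega_1\\ \omega_3&-\omega_2&\omega_1&0\end{bmatrix},$$ and $$\mathbf A(\mathbf q)=\begin{bmatrix}q_0^2+q_1^2-q_2^2-q_3^2&2(q_1q_2-q_0q_3)&2(q_1q_3+q_0q_2)\\2(q_1q_2+q_0q_3)&q_0^2-q_1^2+q_2^2-q_3^2&2(q_2q_3-q_0q_1)\\2(q_1q_3-q_0q_2)&2(q_2q_3+q_0q_1)&q_0^2-q_1^2-q_2^2+q_3^2\end{bmatrix}.$$ A rotation of angle $\theta$ about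 the unit vector $\mathbf n$ is represented by the quaternion $\mathbf q=(\cos(\theta/2),\mathbf n\sin(\theta/2))^T$.
   Formalization: The formal theorem additionally assumes that the instants tend to infinity, that the gaps Δt_i are bounded above, and that the acceleration γ is bounded; without bounded gaps or bounded γ the claimed exponential convergence in time can fail. *)

theory Defs
  imports "HOL-Analysis.Analysis"
begin

text \<open>
  Quaternions are vectors in \<open>real ^ 4\<close>, the components \<open>q\<^sub>0, q\<^sub>1, q\<^sub>2, q\<^sub>3\<close> being
  \<open>q $ 1, q $ 2, q $ 3, q $ 4\<close>. They are not required to have norm 1: the flow preserves the
  norm of the true quaternion, but the updates do not keep the estimate on the unit sphere.
\<close>

definition Omega :: "real ^ 3 \<Rightarrow> real ^ 4 ^ 4" where
  "Omega w = (let w1 = w $ 1; w2 = w $ 2; w3 = w $ 3 in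
     vector [vector [ 0, - w1, - w2, - w3],
             vector [w1,    0, - w3,   w2],
             vector [w2,   w3,    0, - w1],
             vector [w3, - w2,   w1,    0]])"

definition rot_mat :: "real ^ 4 \<Rightarrow> real ^ 3 ^ 3" where
  "rot_mat q = (let q0 = q $ 1; q1 = q $ 2; q2 = q $ 3; q3 = q $ 4 in
     vector [vector [q0\<^sup>2 + q1\<^sup>2 - q2\<^sup>2 - q3\<^sup>2, 2 * (q1 * q2 - q0 * q3), 2 * (q1 * q3 + q0 * q2)],
             vector [2 * (q1 * q2 + q0 * q3), q0\<^sup>2 - q1\<^sup>2 + q2\<^sup>2 - q3\<^sup>2, 2 * (q2 * q3 - q0 * q1)],
             vector [2 * (q1 * q3 - q0 * q2), 2 * (q2 * q3 + q0 * q1), q0\<^sup>2 - q1\<^sup>2 - q2\<^sup>2 + q3\<^sup>2]])"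

definition eigenvalue :: "real ^ 'n ^ 'n \<Rightarrow> real \<Rightarrow> bool" where
  "eigenvalue M c \<longleftrightarrow> (\<exists>x. x \<noteq> 0 \<and> M *v x = c *\<^sub>R x)"

text \<open>Only meaningful if \<open>M\<close> has a real eigenvalue; used below for symmetric matrices.\<close>

definition largest_eigenvalue :: "real ^ 'n ^ 'n \<Rightarrow> real" where
  "largest_eigenvalue M = (GREATEST c. eigenvalue M c)"

definition strapdown_solution ::
  "(real \<Rightarrow> real ^ 3) \<Rightarrow> (real \<Rightarrow> real ^ 3) \<Rightarrow> real set \<Rightarrow>
   (real \<Rightarrow> real ^ 4) \<Rightarrow> (real \<Rightarrow> real ^ 3) \<Rightarrow> (real \<Rightarrow> real ^ 3) \<Rightarrow> bool" where
  "strapdown_solution \<omega> \<gamma> S q v r \<longleftrightarrow> (\<forall>s\<in>S.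
     (q has_vector_derivative (1 / 2) *\<^sub>R (Omega (\<omega> s) *v q s)) (at s within S) \<and>
     (v has_vector_derivative rot_mat (q s) *v \<gamma> s) (at s within S) \<and>
     (r has_vector_derivative v s) (at s within S))"

text \<open>
  The estimates \<open>qh, vh, rh\<close> are right-continuous: at an update instant their value is the one
  after the update, and the value before the update is the left limit \<open>qm, vm, rm\<close>.
  The estimates start at time \<open>t 0\<close> from arbitrary values, and the updates take place at
  \<open>t 1, t 2, \<dots>\<close>. An additional update of the attitude and position estimates at \<open>t 0\<close> would
  only change these arbitrary starting values.
\<close>

definition sampled_observer ::
  "(nat \<Rightarrow> real) \<Rightarrow> (real \<Rightarrow> real ^ 3) \<Rightarrow> (real \<Rightarrow> real ^ 3) \<Rightarrow>
   (nat \<Rightarrow> real ^ 4 ^ 4) \<Rightarrow> (nat \<Rightarrow> real ^ 3 ^ 3) \<Rightarrow> (nat \<Rightarrow> real ^ 4) \<Rightarrow> (nat \<Rightarrow> real ^ 3) \<Rightarrow>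
   (real \<Rightarrow> real ^ 4) \<Rightarrow> (real \<Rightarrow> real ^ 3) \<Rightarrow> (real \<Rightarrow> real ^ 3) \<Rightarrow> bool" where
  "sampled_observer t \<omega> \<gamma> F1 F3 q_meas r_meas qh vh rh \<longleftrightarrow>
     (\<forall>i. strapdown_solution \<omega> \<gamma> {t i..<t (Suc i)} qh vh rh) \<and>
     (\<forall>i. \<exists>qm vm rm.
        (qh \<longlongrightarrow> qm) (at_left (t (Suc i))) \<and>
        (vh \<longlongrightarrow> vm) (at_left (t (Suc i))) \<and>
        (rh \<longlongrightarrow> rm) (at_left (t (Suc i))) \<and>
        qh (t (Suc i)) = F1 (Suc i) *v qm + (mat 1 - F1 (Suc i)) *v q_meas (Suc i) \<and>
        vh (t (Suc i)) = vm - (1 / (t (Suc i) - t i)) *\<^sub>R integral {t i..t (Suc i)} vh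
                            + (1 / (t (Suc i) - t i)) *\<^sub>R (r_meas (Suc i) - r_meas i) \<and>
        rh (t (Suc i)) = F3 (Suc i) *v rm + (mat 1 - F3 (Suc i)) *v r_meas (Suc i))"

definition tends_exponentially ::
  "real \<Rightarrow> (real \<Rightarrow> 'a::real_normed_vector) \<Rightarrow> (real \<Rightarrow> 'a) \<Rightarrow> bool" where
  "tends_exponentially t0 xh x \<longleftrightarrow>
     (\<exists>K \<mu>. \<mu> > 0 \<and> (\<forall>s\<ge>t0. norm (xh s - x s) \<le> K * exp (- \<mu> * (s - t0))))"

end

theory Submission
  imports Defs
begin

text \<open>
  Since \<open>\<Omega>\<close> is skew-symmetric, the attitude error keeps its norm between the updates, and every
  update contracts it. The velocity error thus has a geometrically decaying derivative on the
  \<open>i\<close>-th interval. The velocity update subtracts the mean of the velocity error over the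
  preceding interval from its left limit; what is left is at most the oscillation of the error,
  so it inherits the geometric decay. The position error satisfies a contractive recursion with a
  geometrically decaying forcing term. Bounded gaps turn geometric decay in \<open>i\<close> into exponential
  decay in time.
\<close>

section \<open>Gain matrices: spectral bound and effect on the error\<close>

text \<open>On the compact unit sphere \<open>norm (F *v y)\<close> attains its maximum at some
  \<open>z\<close>. This maximiser is an eigenvector of \<open>transpose F ** F\<close>, and its
  eigenvalue \<open>c\<close> dominates all others, because every eigenvalue is the Rayleigh
  quotient of its eigenvector. So the greatest eigenvalue exists and equals the squared operator
  norm.\<close>

lemma norm_matrix_vector_mult_le_largest_eigenvalue:
  fixes F :: "real ^ 'n ^ 'm"
  shows "(norm (F *v x))\<^sup>2 \<le> largest_eigenvalue (transpose F ** F) * (norm x)\<^sup>2"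
proof -
  let ?M = "transpose F ** F"
  have M: "(?M *v x) \<bullet> y = (F *v x) \<bullet> (F *v y)" for x y
    by (simp add: dot_lmul_matrix flip: matrix_vector_mul_assoc)
  obtain z where z: "norm z = 1"
    and zmax: "\<And>y. norm y = 1 \<Longrightarrow> norm (F *v y) \<le> norm (F *v z)"
  proof -
    have "\<exists>z\<in>sphere (0::real^'n) 1. \<forall>y\<in>sphere 0 1. norm (F *v y) \<le> norm (F *v z)"
    proof (rule continuous_attains_sup)
      show "continuous_on (sphere (0::real^'n) 1) (\<lambda>y. norm (F *v y))"
        by (intro continuous_intros linear_continuous_on_compose[OF continuous_on_id]
            matrix_vector_mul_linear)
    qed auto
    then show ?thesis using that by auto
  qed
  define c where "c = (norm (F *v z))\<^sup>2"
  have bound: "(norm (F *v y))\<^sup>2 \<le> c * (norm y)\<^sup>2" for y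
  proof (cases "y = 0")
    case False
    have "norm (F *v ((1 / norm y) *\<^sub>R y)) \<le> norm (F *v z)"
      using False by (intro zmax) simp
    then have "norm (F *v y) \<le> norm (F *v z) * norm y"
      using False by (simp add: matrix_vector_mult_scaleR divide_simps)
    then show ?thesis
      unfolding c_def power_mult_distrib[symmetric] by (simp add: power_mono)
  qed simp
  have "?M *v z = c *\<^sub>R z"
    \<comment> \<open>the nonnegative form \<open>c |y|^2 - |F y|^2\<close> vanishes at \<open>z\<close>, so its gradient \<open>2 u\<close> there vanishes\<close>
  proof -
    define u where "u = c *\<^sub>R z - ?M *v z"
    have zz: "z \<bullet> z = 1" using z by (simp add: dot_square_norm)
    have nonneg: "0 \<le> 2 * s * (u \<bullet> u) + s\<^sup>2 * (c * (u \<bullet> u) - (F *v u) \<bullet> (F *v u))" for s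
    proof -
      have expand: "(y + s *\<^sub>R y') \<bullet> (y + s *\<^sub>R y') = y \<bullet> y + 2 * s * (y \<bullet> y') + s\<^sup>2 * (y' \<bullet> y')"
        for y y' :: "real ^ 'k"
        by (simp add: inner_commute[of y' y] power2_eq_square algebra_simps)
      have "(F *v z + s *\<^sub>R (F *v u)) \<bullet> (F *v z + s *\<^sub>R (F *v u))
          \<le> c * ((z + s *\<^sub>R u) \<bullet> (z + s *\<^sub>R u))"
        using bound[of "z + s *\<^sub>R u"]
        by (simp add: power2_norm_eq_inner matrix_vector_right_distrib matrix_vector_mult_scaleR)
      then have "c + 2 * s * ((F *v z) \<bullet> (F *v u)) + s\<^sup>2 * ((F *v u) \<bullet> (F *v u))
          \<le> c * (1 + 2 * s * (z \<bullet> u) + s\<^sup>2 * (u \<bullet> u))"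
        unfolding expand zz by (simp add: c_def power2_norm_eq_inner)
      also have "\<dots> = c + 2 * s * (c * (z \<bullet> u)) + s\<^sup>2 * (c * (u \<bullet> u))"
        by (simp add: algebra_simps)
      \<comment> \<open>By definition of \<open>u\<close>, \<open>c *\<^sub>R z\<close> is
        \<open>u\<close> plus the image of \<open>z\<close>, so after cancellation the linear
        coefficient is just \<open>2 * (u \<bullet> u)\<close>.\<close>
      also have "c * (z \<bullet> u) = u \<bullet> u + (F *v z) \<bullet> (F *v u)"
        unfolding M[symmetric] by (subst (2) u_def) (simp add: inner_diff_left)
      finally show ?thesis by (simp add: algebra_simps)
    qed
    have "u \<bullet> u = 0"
    proof (rule ccontr)
      assume "u \<bullet> u \<noteq> 0"
      then have pos: "u \<bullet> u > 0" by simp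
      \<comment> \<open>A positive upper bound for the quadratic coefficient, whatever its sign. At
        \<open>s = - (u \<bullet> u) / d\<close> the linear term outweighs the quadratic one, which
        makes the form negative.\<close>
      define d where "d = \<bar>c * (u \<bullet> u) - (F *v u) \<bullet> (F *v u)\<bar> + u \<bullet> u"
      have d: "d > 0" "c * (u \<bullet> u) - (F *v u) \<bullet> (F *v u) \<le> d"
        unfolding d_def using pos by linarith+
      have "0 \<le> 2 * (- (u \<bullet> u) / d) * (u \<bullet> u) + (- (u \<bullet> u) / d)\<^sup>2 * d"
        by (rule order_trans[OF nonneg add_left_mono[OF mult_left_mono[OF d(2)]]]) simp
      also have "\<dots> = - (u \<bullet> u)\<^sup>2 / d" using d by (simp add: field_simps power2_eq_square)
      finally show False using pos d by (simp add: field_simps)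
    qed
    then show ?thesis by (simp add: u_def)
  qed
  moreover have "z \<noteq> 0" using z by auto
  ultimately have "eigenvalue ?M c" by (auto simp: eigenvalue_def)
  moreover have "d \<le> c" if d: "eigenvalue ?M d" for d
  proof -
    obtain y where y: "y \<noteq> 0" "?M *v y = d *\<^sub>R y" using d by (auto simp: eigenvalue_def)
    have "d * (norm y)\<^sup>2 = (norm (F *v y))\<^sup>2"
      using M[of y y] y by (simp add: power2_norm_eq_inner)
    also have "\<dots> \<le> c * (norm y)\<^sup>2" by (rule bound)
    finally show ?thesis using y by simp
  qed
  ultimately have "largest_eigenvalue ?M = c"
    unfolding largest_eigenvalue_def by (rule Greatest_equality)
  with bound show ?thesis by simp
qed

lemma norm_matrix_vector_mult_le_sqrt:
  fixes F :: "real ^ 'n ^ 'm"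
  assumes "largest_eigenvalue (transpose F ** F) \<le> \<beta>"
  shows "norm (F *v x) \<le> sqrt \<beta> * norm x"
proof -
  have "(norm (F *v x))\<^sup>2 \<le> \<beta> * (norm x)\<^sup>2"
    using norm_matrix_vector_mult_le_largest_eigenvalue[of F x] assms
    by (meson mult_right_mono order_trans zero_le_power2)
  then have "sqrt ((norm (F *v x))\<^sup>2) \<le> sqrt (\<beta> * (norm x)\<^sup>2)" by (rule real_sqrt_le_mono)
  then show ?thesis by (simp add: real_sqrt_mult)
qed

text \<open>The weights \<open>F\<close> and \<open>mat 1 - F\<close> add up to the identity and
  thus reproduce the true value \<open>x\<close>; an update therefore acts on the error as
  multiplication by \<open>F\<close>.\<close>

lemma correction_diff_eq:
  fixes F :: "real ^ 'n ^ 'n"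
  shows "F *v xm + (mat 1 - F) *v x - x = F *v (xm - x)"
  by (simp add: matrix_vector_mult_diff_distrib matrix_vector_mult_diff_rdistrib)

section \<open>Attitude kinematics and the rotation matrix\<close>

lemma vector_4:
  "(vector [w, x, y, z] :: 'a::zero ^ 4) $ 1 = w"
  "(vector [w, x, y, z] :: 'a ^ 4) $ 2 = x"
  "(vector [w, x, y, z] :: 'a ^ 4) $ 3 = y"
  "(vector [w, x, y, z] :: 'a ^ 4) $ 4 = z"
  unfolding vector_def by simp_all

text \<open>Skew-symmetry of \<open>Omega w\<close>: the velocity of a quaternion is orthogonal to
  the quaternion.\<close>

lemma inner_Omega_eq_0: "x \<bullet> (Omega w *v x) = 0"
  by (simp add: Omega_def Let_def matrix_vector_mult_def inner_vec_def sum_4 vector_4 algebra_simps)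

text \<open>The entries are quadratic forms, so they are Lipschitz only up to the factor
  \<open>norm x + norm y\<close>; this covers estimates that leave the unit sphere. The constant 36
  is crude: 4 for each of the 9 entries.\<close>

lemma norm_rot_mat_diff_le:
  "norm (rot_mat x *v g - rot_mat y *v g) \<le> 36 * (norm (x - y) * (norm x + norm y)) * norm g"
proof -
  let ?B = "norm (x - y) * (norm x + norm y)"
  have prod: "\<bar>x $ j * x $ k - y $ j * y $ k\<bar> \<le> ?B" for j k
  proof -
    have "x $ j * x $ k - y $ j * y $ k = (x - y) $ j * x $ k + y $ j * (x - y) $ k"
      by (simp add: algebra_simps)
    also have "\<bar>\<dots>\<bar> \<le> norm (x - y) * norm x + norm y * norm (x - y)"
      by (intro order_trans[OF abs_triangle_ineq] add_mono)
        (auto simp: abs_mult simp del: vector_minus_component intro!: mult_mono component_le_norm_cart)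
    finally show ?thesis by (simp add: algebra_simps)
  qed
  have entry: "\<bar>(rot_mat x - rot_mat y) $ j $ k\<bar> \<le> 4 * ?B" for j k
  proof -
    \<comment> \<open>Each entry of the difference combines the numbers \<open>m j k\<close> with
      coefficients whose absolute values sum to 4: four times 1 on the diagonal, twice 2 off
      it.\<close>
    define m where "m j k = x $ j * x $ k - y $ j * y $ k" for j k
    have upper: "m j k \<le> ?B" and lower: "- ?B \<le> m j k" for j k
      using prod[of j k] unfolding m_def by linarith+
    let ?D = "rot_mat x - rot_mat y"
    have "?D $ 1 $ 1 = m 1 1 + m 2 2 - m 3 3 - m 4 4" "?D $ 1 $ 2 = 2 * m 2 3 - 2 * m 1 4"
      "?D $ 1 $ 3 = 2 * m 2 4 + 2 * m 1 3" "?D $ 2 $ 1 = 2 * m 2 3 + 2 * m 1 4"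
      "?D $ 2 $ 2 = m 1 1 - m 2 2 + m 3 3 - m 4 4" "?D $ 2 $ 3 = 2 * m 3 4 - 2 * m 1 2"
      "?D $ 3 $ 1 = 2 * m 2 4 - 2 * m 1 3" "?D $ 3 $ 2 = 2 * m 3 4 + 2 * m 1 2"
      "?D $ 3 $ 3 = m 1 1 - m 2 2 - m 3 3 + m 4 4"
      by (simp_all add: rot_mat_def Let_def m_def power2_eq_square)
    moreover have "\<bar>m a b + m c d - m e f - m g h\<bar> \<le> 4 * ?B" "\<bar>m a b - m c d + m e f - m g h\<bar> \<le> 4 * ?B"
      "\<bar>m a b - m c d - m e f + m g h\<bar> \<le> 4 * ?B"
      "\<bar>2 * m a b + 2 * m c d\<bar> \<le> 4 * ?B" "\<bar>2 * m a b - 2 * m c d\<bar> \<le> 4 * ?B" for a b c d e f g h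
      using upper[of a b] upper[of c d] upper[of e f] upper[of g h]
        lower[of a b] lower[of c d] lower[of e f] lower[of g h]
      unfolding abs_le_iff by linarith+
    ultimately show ?thesis
      using exhaust_3[of j] exhaust_3[of k] by (elim disjE) (simp_all only:)
  qed
  have comp: "\<bar>((rot_mat x - rot_mat y) *v g) $ j\<bar> \<le> 12 * ?B * norm g" for j
  proof -
    have "\<bar>((rot_mat x - rot_mat y) *v g) $ j\<bar> \<le> (\<Sum>k\<in>UNIV. \<bar>(rot_mat x - rot_mat y) $ j $ k * g $ k\<bar>)"
      unfolding matrix_vector_mult_def vec_lambda_beta by (rule sum_abs)
    also have "\<dots> \<le> (\<Sum>k\<in>(UNIV :: 3 set). 4 * ?B * norm g)"
      unfolding abs_mult by (intro sum_mono mult_mono entry component_le_norm_cart) auto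
    finally show ?thesis by simp
  qed
  have "norm ((rot_mat x - rot_mat y) *v g) \<le> (\<Sum>j\<in>UNIV. \<bar>((rot_mat x - rot_mat y) *v g) $ j\<bar>)"
    by (rule norm_le_l1_cart)
  also have "\<dots> \<le> (\<Sum>j\<in>(UNIV :: 3 set). 12 * ?B * norm g)"
    by (intro sum_mono comp)
  finally show ?thesis by (simp add: matrix_vector_mult_diff_rdistrib)
qed

section \<open>Calculus on one sampling interval\<close>

text \<open>The derivative of \<open>e s \<bullet> e s\<close> is
  \<open>2 * (e s \<bullet> e' s) = 0\<close>.\<close>

lemma norm_constant_if_velocity_orthogonal:
  fixes e :: "real \<Rightarrow> 'a::real_inner"
  assumes "convex S"
    and deriv: "\<And>s. s \<in> S \<Longrightarrow> (e has_vector_derivative e' s) (at s within S)"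
    and orth: "\<And>s. s \<in> S \<Longrightarrow> e s \<bullet> e' s = 0"
    and "x \<in> S" "y \<in> S"
  shows "norm (e x) = norm (e y)"
proof -
  have "((\<lambda>s. e s \<bullet> e s) has_derivative (\<lambda>h. 0)) (at s within S)" if "s \<in> S" for s
  proof -
    have "((\<lambda>s. e s \<bullet> e s) has_derivative
        (\<lambda>h. e s \<bullet> (h *\<^sub>R e' s) + (h *\<^sub>R e' s) \<bullet> e s)) (at s within S)"
      using deriv[OF that] unfolding has_vector_derivative_def
      by (intro has_derivative_inner)
    then show ?thesis using orth[OF that] by (simp add: inner_commute)
  qed
  from has_derivative_zero_constant[OF assms(1) this]
  obtain c where "\<And>s. s \<in> S \<Longrightarrow> e s \<bullet> e s = c" by blast
  then show ?thesis using assms by (simp add: norm_eq_sqrt_inner)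
qed

text \<open>Mean value inequality on a half-open interval; the right end is excluded because the
  estimates may jump there.\<close>

lemma norm_increment_le:
  fixes f :: "real \<Rightarrow> 'a::real_normed_vector"
  assumes deriv: "\<And>s. s \<in> {a..<b} \<Longrightarrow> (f has_vector_derivative f' s) (at s within {a..<b})"
    and bound: "\<And>s. s \<in> {a..<b} \<Longrightarrow> norm (f' s) \<le> B"
    and "a \<le> x" "x \<le> y" "y < b"
  shows "norm (f y - f x) \<le> B * (y - x)"
proof -
  have "norm (f y - f x) \<le> B * norm (y - x)"
  proof (rule differentiable_bound)
    show "convex {a..<b}" by simp
    fix s assume s: "s \<in> {a..<b}"
    show "(f has_derivative (\<lambda>h. h *\<^sub>R f' s)) (at s within {a..<b})"
      using deriv[OF s] by (simp add: has_vector_derivative_def)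
    show "onorm (\<lambda>h. h *\<^sub>R f' s) \<le> B"
      using mult_right_mono[OF bound[OF s] abs_ge_zero] by (intro onorm_le) (simp add: mult.commute)
  qed (use assms in auto)
  then show ?thesis using assms by simp
qed

text \<open>The preceding estimate survives the passage \<open>y\<close> to \<open>b\<close> from
  the left. It reaches the value just before an update.\<close>

lemma norm_increment_left_limit_le:
  fixes f :: "real \<Rightarrow> 'a::real_normed_vector"
  assumes deriv: "\<And>s. s \<in> {a..<b} \<Longrightarrow> (f has_vector_derivative f' s) (at s within {a..<b})"
    and bound: "\<And>s. s \<in> {a..<b} \<Longrightarrow> norm (f' s) \<le> B"
    and lim: "(f \<longlongrightarrow> l) (at_left b)"
    and "a \<le> x" "x < b"
  shows "norm (l - f x) \<le> B * (b - x)"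
proof (rule tendsto_le[OF trivial_limit_at_left_real])
  show "((\<lambda>y. B * (y - x)) \<longlongrightarrow> B * (b - x)) (at_left b)" by (intro tendsto_intros)
  show "((\<lambda>y. norm (f y - f x)) \<longlongrightarrow> norm (l - f x)) (at_left b)"
    by (intro tendsto_intros lim)
  show "\<forall>\<^sub>F y in at_left b. norm (f y - f x) \<le> B * (y - x)"
    using eventually_at_left_real[OF \<open>x < b\<close>]
    by eventually_elim (use assms in \<open>auto intro!: norm_increment_le[OF deriv bound]\<close>)
qed

text \<open>Fundamental theorem of calculus for a function that may jump at \<open>b\<close>:
  replacing its value there by the left limit gives a function continuous on the closed interval. It
  evaluates the integral in the velocity update.\<close>

lemma has_integral_left_limit:
  fixes f :: "real \<Rightarrow> 'a::banach"
  assumes "a < b"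
    and deriv: "\<And>s. s \<in> {a..<b} \<Longrightarrow> (f has_vector_derivative f' s) (at s within {a..<b})"
    and lim: "(f \<longlongrightarrow> l) (at_left b)"
  shows "(f' has_integral (l - f a)) {a..b}"
proof -
  define g where "g s = (if s = b then l else f s)" for s
  have "(f' has_integral (g b - g a)) {a..b}"
  proof (rule fundamental_theorem_of_calculus_interior)
    show "continuous_on {a..b} g"
      unfolding continuous_on_eq_continuous_within
    proof
      fix s assume s: "s \<in> {a..b}"
      show "continuous (at s within {a..b}) g"
      proof (cases "s = b")
        case True
        have "(g \<longlongrightarrow> l) (at_left b)"
          by (rule Lim_transform_eventually[OF lim])
            (auto simp: g_def eventually_at_filter)
        then show ?thesis
          using True \<open>a < b\<close> by (simp add: continuous_within g_def at_within_Icc_at_left)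
      next
        case False
        with s have s': "s \<in> {a..<b}" by auto
        have "continuous (at s within {a..<b}) f"
          using deriv[OF s'] by (rule has_vector_derivative_continuous)
        moreover have "at s within {a..<b} = at s within {a..b}"
          by (rule at_within_nhd[of _ "{..<b}"]) (use s' in auto)
        ultimately have "(f \<longlongrightarrow> f s) (at s within {a..b})" by (simp add: continuous_within)
        moreover have "\<forall>\<^sub>F y in at s within {a..b}. f y = g y"
          unfolding eventually_at_topological
          by (intro exI[of _ "{..<b}"]) (use s' in \<open>auto simp: g_def\<close>)
        ultimately have "(g \<longlongrightarrow> f s) (at s within {a..b})" by (rule Lim_transform_eventually)
        then show ?thesis using False by (simp add: continuous_within g_def)
      qed
    qed
    fix s assume s: "s \<in> {a<..<b}"
    have "(f has_vector_derivative f' s) (at s within {a<..<b})"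
      by (rule has_vector_derivative_within_subset[OF deriv]) (use s in auto)
    then have "(f has_vector_derivative f' s) (at s)"
      using s by (simp only: at_within_open[of s "{a<..<b}"] open_greaterThanLessThan)
    then show "(g has_vector_derivative f' s) (at s)"
      by (rule has_vector_derivative_transform_within_open[of f _ s "{a<..<b}"])
        (use s in \<open>auto simp: g_def\<close>)
  qed (use \<open>a < b\<close> in auto)
  then show ?thesis using \<open>a < b\<close> by (simp add: g_def)
qed

text \<open>The quotient \<open>(pm - p a) / (b - a)\<close> is the mean of \<open>w\<close>, and
  every value of \<open>w\<close> is within \<open>B * (b - a)\<close> of \<open>wm\<close>. Instead
  of averaging by an integral, the proof bounds the increment of
  \<open>s *\<^sub>R wm - p s\<close>, whose derivative is \<open>wm - w s\<close>.\<close>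

lemma left_limit_minus_mean_le:
  fixes p w :: "real \<Rightarrow> 'a::real_normed_vector"
  assumes "a < b"
    and p: "\<And>s. s \<in> {a..<b} \<Longrightarrow> (p has_vector_derivative w s) (at s within {a..<b})"
    and w: "\<And>s. s \<in> {a..<b} \<Longrightarrow> (w has_vector_derivative w' s) (at s within {a..<b})"
    and bound: "\<And>s. s \<in> {a..<b} \<Longrightarrow> norm (w' s) \<le> B"
    and limits: "(p \<longlongrightarrow> pm) (at_left b)" "(w \<longlongrightarrow> wm) (at_left b)"
  shows "norm (wm - (1 / (b - a)) *\<^sub>R (pm - p a)) \<le> B * (b - a)"
proof -
  let ?f = "\<lambda>s. s *\<^sub>R wm - p s"
  have B: "B \<ge> 0" using order_trans[OF norm_ge_zero bound[of a]] \<open>a < b\<close> by simp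
  have "norm ((b *\<^sub>R wm - pm) - ?f a) \<le> (B * (b - a)) * (b - a)"
  proof (rule norm_increment_left_limit_le[where f = ?f and f' = "\<lambda>s. wm - w s"])
    fix s assume s: "s \<in> {a..<b}"
    show "(?f has_vector_derivative wm - w s) (at s within {a..<b})"
      by (rule derivative_eq_intros p[OF s] refl | simp)+
    have "norm (wm - w s) \<le> B * (b - s)"
      using s by (intro norm_increment_left_limit_le[OF w bound limits(2)]) auto
    also have "\<dots> \<le> B * (b - a)" using s B by (intro mult_left_mono) auto
    finally show "norm (wm - w s) \<le> B * (b - a)" .
  next
    show "(?f \<longlongrightarrow> b *\<^sub>R wm - pm) (at_left b)" by (intro tendsto_intros limits)
  qed (use \<open>a < b\<close> in auto)
  then have "norm ((1 / (b - a)) *\<^sub>R ((b *\<^sub>R wm - pm) - ?f a)) \<le> B * (b - a)"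
    using \<open>a < b\<close> by (simp add: divide_le_eq)
  moreover have "wm - (1 / (b - a)) *\<^sub>R (pm - p a) = (1 / (b - a)) *\<^sub>R ((b *\<^sub>R wm - pm) - ?f a)"
  proof -
    have "(b *\<^sub>R wm - pm) - ?f a = (b - a) *\<^sub>R wm - (pm - p a)" by (simp add: algebra_simps)
    then show ?thesis using \<open>a < b\<close> by (simp only: scaleR_diff_right[of _ "_ *\<^sub>R wm"]) simp
  qed
  ultimately show ?thesis by simp
qed

section \<open>From recursions at the instants to exponential decay in time\<close>

text \<open>Contraction and forcing share the rate \<open>a\<close>, so the solution may behave like
  \<open>i * a ^ i\<close>; any slower rate \<open>b\<close> absorbs the factor \<open>i\<close>.
  The constant \<open>M\<close> in front of \<open>b ^ i\<close> is chosen so that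
  \<open>a * (M + C) \<le> b * M\<close>, which is the induction step.\<close>

lemma contractive_recursion_bound:
  fixes x :: "nat \<Rightarrow> real"
  assumes "0 < a" "a < b"
    and step: "\<And>i. x (Suc i) \<le> a * (x i + C * a ^ i)"
    and "C \<ge> 0"
  shows "x i \<le> (\<bar>x 0\<bar> + a * C / (b - a)) * b ^ i"
proof (induction i)
  case 0
  then show ?case using assms by (simp add: add_increasing2)
next
  case (Suc i)
  let ?M = "\<bar>x 0\<bar> + a * C / (b - a)"
  have "a * (?M + C) = b * ?M - (b - a) * \<bar>x 0\<bar>" using assms by (simp add: field_simps)
  also have "\<dots> \<le> b * ?M" using assms by simp
  finally have M: "a * (?M + C) \<le> b * ?M" .
  have "x (Suc i) \<le> a * (x i + C * a ^ i)" by (rule step)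
  also have "\<dots> \<le> a * (?M * b ^ i + C * b ^ i)"
    using assms Suc by (intro mult_left_mono add_mono power_mono) auto
  also have "\<dots> = a * (?M + C) * b ^ i" by (simp add: algebra_simps)
  also have "\<dots> \<le> b * ?M * b ^ i" using assms by (intro mult_right_mono M) auto
  finally show ?case by (simp add: mult_ac)
qed

text \<open>The least \<open>n\<close> with \<open>s < t n\<close> exists because \<open>t\<close>
  is unbounded, and it is not 0 because \<open>t 0 \<le> s\<close>; its predecessor is the index
  sought.\<close>

lemma sampling_interval_exists:
  fixes t :: "nat \<Rightarrow> real"
  assumes "filterlim t at_top sequentially" "t 0 \<le> s"
  obtains i where "t i \<le> s" "s < t (Suc i)"
proof -
  have "\<exists>n. s < t n"
    using assms(1) eventually_happens' trivial_limit_sequentially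
    unfolding filterlim_at_top_dense by blast
  then have less: "s < t (LEAST n. s < t n)" by (rule LeastI_ex)
  with assms(2) obtain i where i: "(LEAST n. s < t n) = Suc i"
    by (cases "LEAST n. s < t n") auto
  then have "\<not> s < t i" using not_less_Least[of i "\<lambda>n. s < t n"] by simp
  then show ?thesis using less i by (intro that[of i]) simp_all
qed

text \<open>Before \<open>t (Suc i)\<close> at most \<open>Suc i\<close> gaps of length at most
  \<open>T\<close> have elapsed, so \<open>b ^ Suc i\<close> lies below the exponential of rate
  \<open>- ln b / T\<close>. Passing from \<open>b ^ i\<close> to \<open>b ^ Suc i\<close> costs the
  factor \<open>1 / b\<close>.\<close>

lemma tends_exponentially_if_geometric:
  fixes t :: "nat \<Rightarrow> real"
  assumes "filterlim t at_top sequentially"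
    and gaps: "\<And>i. t (Suc i) - t i \<le> T" and "0 < T"
    and b: "0 < b" "b < 1"
    and bound: "\<And>i s. t i \<le> s \<Longrightarrow> s < t (Suc i) \<Longrightarrow> norm (xh s - x s) \<le> K * b ^ i"
    and "K \<ge> 0"
  shows "tends_exponentially (t 0) xh x"
proof -
  define \<mu> where "\<mu> = - ln b / T"
  have \<mu>: "\<mu> > 0" using b \<open>0 < T\<close> by (simp add: \<mu>_def divide_neg_pos)
  have elapsed: "t i - t 0 \<le> real i * T" for i
  proof (induction i)
    case (Suc i)
    then show ?case using gaps[of i] by (simp add: algebra_simps)
  qed simp
  have "norm (xh s - x s) \<le> (K / b) * exp (- \<mu> * (s - t 0))" if s: "s \<ge> t 0" for s
  proof -
    obtain i where i: "t i \<le> s" "s < t (Suc i)" using sampling_interval_exists[OF assms(1) s] .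
    have "b ^ Suc i = exp (real (Suc i) * ln b)" using b by (simp only: exp_of_nat_mult exp_ln)
    also have "\<dots> = exp (- \<mu> * (real (Suc i) * T))" using \<open>0 < T\<close> by (simp add: \<mu>_def)
    also have "\<dots> \<le> exp (- \<mu> * (s - t 0))"
      using \<mu> i elapsed[of "Suc i"] by simp
    finally have "(K / b) * b ^ Suc i \<le> (K / b) * exp (- \<mu> * (s - t 0))"
      using \<open>K \<ge> 0\<close> b by (intro mult_left_mono) auto
    then show ?thesis using bound[OF i] b by simp
  qed
  with \<mu> show ?thesis unfolding tends_exponentially_def by blast
qed

text \<open>The true motion does not jump: at an update instant, an interior point of the time axis,
  its left limit is its value.\<close>

lemma tendsto_at_left_if_has_vector_derivative:
  assumes "(f has_vector_derivative f') (at b within {a..})" "a < b"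
  shows "(f \<longlongrightarrow> f b) (at_left b)"
proof -
  have "(f \<longlongrightarrow> f b) (at b within {a..})"
    using has_vector_derivative_continuous[OF assms(1)] by (simp add: continuous_within)
  moreover have "at b within {a..} = at b"
    by (rule at_within_interior) (use assms(2) in auto)
  ultimately show ?thesis by (simp add: filterlim_at_split)
qed

theorem mainTheorem1:
  fixes t :: "nat \<Rightarrow> real"
    and \<omega> \<gamma> :: "real \<Rightarrow> real ^ 3"
    and q qh :: "real \<Rightarrow> real ^ 4"
    and v vh r rh :: "real \<Rightarrow> real ^ 3"
    and F1 :: "nat \<Rightarrow> real ^ 4 ^ 4"
    and F3 :: "nat \<Rightarrow> real ^ 3 ^ 3"
    and \<alpha> :: real
  assumes instants: "strict_mono t" "filterlim t at_top sequentially"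
    and bounded_gaps: "bdd_above (range (\<lambda>i. t (Suc i) - t i))"
    and bounded_acceleration: "bounded (\<gamma> ` {t 0..})"
    and system: "strapdown_solution \<omega> \<gamma> {t 0..} q v r"
    and observer: "sampled_observer t \<omega> \<gamma> F1 F3 (\<lambda>i. q (t i)) (\<lambda>i. r (t i)) qh vh rh"
    and "\<alpha> < 1"
    and "\<And>i. largest_eigenvalue (transpose (F1 i) ** F1 i) \<le> \<alpha>"
    and "\<And>i. largest_eigenvalue (transpose (F3 i) ** F3 i) \<le> \<alpha>"
  shows "tends_exponentially (t 0) qh q \<and>
         tends_exponentially (t 0) vh v \<and>
         tends_exponentially (t 0) rh r"
proof -

  \<comment> \<open>Uniform constants for the gains, the gaps and the acceleration\<close>
  \<comment> \<open>The square root turns a bound on the eigenvalues into one on the operator norm.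
    The maximum with 1/2 keeps \<open>a\<close> positive, as needed for \<open>ln a\<close> and for
    division by \<open>a\<close>.\<close>
  define a where "a = sqrt (max \<alpha> (1 / 2))"
  have a: "0 < a" "a < 1" using \<open>\<alpha> < 1\<close> by (auto simp: a_def less_max_iff_disj)
  have F1: "norm (F1 i *v x) \<le> a * norm x" and F3: "norm (F3 i *v y) \<le> a * norm y" for i x y
    unfolding a_def using assms(8,9)[of i] by (auto intro!: norm_matrix_vector_mult_le_sqrt)
  obtain T where gaps: "\<And>i. t (Suc i) - t i \<le> T"
    using bounded_gaps by (auto simp: bdd_above_def)
  have gap_pos: "t i < t (Suc i)" for i using instants(1) by (simp add: strict_mono_Suc_iff)
  have T: "0 < T" using gaps[of 0] gap_pos[of 0] by linarith
  have t0: "t 0 \<le> t i" for i using instants(1) by (simp add: strict_mono_less_eq)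
  obtain G where G: "\<And>s. s \<ge> t 0 \<Longrightarrow> norm (\<gamma> s) \<le> G" and "G > 0"
    using bounded_acceleration by (auto simp: bounded_pos)

  have sys: "(q has_vector_derivative (1 / 2) *\<^sub>R (Omega (\<omega> s) *v q s)) (at s within {t 0..})"
    "(v has_vector_derivative rot_mat (q s) *v \<gamma> s) (at s within {t 0..})"
    "(r has_vector_derivative v s) (at s within {t 0..})" if "s \<ge> t 0" for s
    using system that by (auto simp: strapdown_solution_def)
  have left: "(q \<longlongrightarrow> q (t (Suc i))) (at_left (t (Suc i)))"
    "(v \<longlongrightarrow> v (t (Suc i))) (at_left (t (Suc i)))"
    "(r \<longlongrightarrow> r (t (Suc i))) (at_left (t (Suc i)))" for i
    using sys[OF t0[of "Suc i"]] t0[of i] gap_pos[of i]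
    by (auto intro: tendsto_at_left_if_has_vector_derivative)

  \<comment> \<open>Error dynamics and error updates\<close>
  define e w p where "e = (\<lambda>s. qh s - q s)" and "w = (\<lambda>s. vh s - v s)" and "p = (\<lambda>s. rh s - r s)"
  define w' where "w' s = rot_mat (qh s) *v \<gamma> s - rot_mat (q s) *v \<gamma> s" for s
  let ?I = "\<lambda>i. {t i..<t (Suc i)}"
  have e_deriv: "(e has_vector_derivative (1 / 2) *\<^sub>R (Omega (\<omega> s) *v e s)) (at s within ?I i)"
    and w_deriv: "(w has_vector_derivative w' s) (at s within ?I i)"
    and p_deriv: "(p has_vector_derivative w s) (at s within ?I i)"
    and rh_deriv: "(rh has_vector_derivative vh s) (at s within ?I i)"
    if s: "s \<in> ?I i" for s i
  proof -
    have obs: "(qh has_vector_derivative (1 / 2) *\<^sub>R (Omega (\<omega> s) *v qh s)) (at s within ?I i)"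
      "(vh has_vector_derivative rot_mat (qh s) *v \<gamma> s) (at s within ?I i)"
      "(rh has_vector_derivative vh s) (at s within ?I i)"
      using observer s by (auto simp: sampled_observer_def strapdown_solution_def)
    have s0: "s \<ge> t 0" and sub: "?I i \<subseteq> {t 0..}" using s t0[of i] by auto
    note sys' = sys[OF s0, THEN has_vector_derivative_within_subset, OF sub]
    \<comment> \<open>The attitude equation is linear with the same measured \<open>Omega\<close>
      for system and observer, so the error obeys it too.\<close>
    show "(e has_vector_derivative (1 / 2) *\<^sub>R (Omega (\<omega> s) *v e s)) (at s within ?I i)"
      using has_vector_derivative_diff[OF obs(1) sys'(1)]
      by (simp add: e_def matrix_vector_mult_diff_distrib scaleR_diff_right)
    show "(w has_vector_derivative w' s) (at s within ?I i)"
      using has_vector_derivative_diff[OF obs(2) sys'(2)] by (simp add: w_def w'_def)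
    show "(p has_vector_derivative w s) (at s within ?I i)"
      using has_vector_derivative_diff[OF obs(3) sys'(3)] by (simp add: w_def p_def)
    show "(rh has_vector_derivative vh s) (at s within ?I i)" by (rule obs)
  qed
  have "\<exists>em wm pm. (e \<longlongrightarrow> em) (at_left (t (Suc i))) \<and> (w \<longlongrightarrow> wm) (at_left (t (Suc i))) \<and>
      (p \<longlongrightarrow> pm) (at_left (t (Suc i))) \<and> e (t (Suc i)) = F1 (Suc i) *v em \<and>
      w (t (Suc i)) = wm - (1 / (t (Suc i) - t i)) *\<^sub>R (pm - p (t i)) \<and>
      p (t (Suc i)) = F3 (Suc i) *v pm" for i
  proof -
    obtain qm vm rm where lim: "(qh \<longlongrightarrow> qm) (at_left (t (Suc i)))"
        "(vh \<longlongrightarrow> vm) (at_left (t (Suc i)))" "(rh \<longlongrightarrow> rm) (at_left (t (Suc i)))"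
      and upd: "qh (t (Suc i)) = F1 (Suc i) *v qm + (mat 1 - F1 (Suc i)) *v q (t (Suc i))"
        "vh (t (Suc i)) = vm - (1 / (t (Suc i) - t i)) *\<^sub>R integral {t i..t (Suc i)} vh
                            + (1 / (t (Suc i) - t i)) *\<^sub>R (r (t (Suc i)) - r (t i))"
        "rh (t (Suc i)) = F3 (Suc i) *v rm + (mat 1 - F3 (Suc i)) *v r (t (Suc i))"
      using observer unfolding sampled_observer_def by blast
    \<comment> \<open>The integral of \<open>vh\<close> is the increment of \<open>rh\<close> up to
      its left limit. Together with the measured increment of \<open>r\<close>, the velocity
      correction becomes the mean of the velocity error.\<close>
    have int: "integral {t i..t (Suc i)} vh = rm - rh (t i)"
      by (rule integral_unique has_integral_left_limit gap_pos rh_deriv lim | assumption)+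
    show ?thesis
    proof (intro exI conjI)
      show "(e \<longlongrightarrow> qm - q (t (Suc i))) (at_left (t (Suc i)))"
        "(w \<longlongrightarrow> vm - v (t (Suc i))) (at_left (t (Suc i)))"
        "(p \<longlongrightarrow> rm - r (t (Suc i))) (at_left (t (Suc i)))"
        unfolding e_def w_def p_def by (intro tendsto_diff lim left)+
      show "e (t (Suc i)) = F1 (Suc i) *v (qm - q (t (Suc i)))"
        "p (t (Suc i)) = F3 (Suc i) *v (rm - r (t (Suc i)))"
        by (simp_all add: e_def p_def upd correction_diff_eq)
      show "w (t (Suc i)) = (vm - v (t (Suc i)))
          - (1 / (t (Suc i) - t i)) *\<^sub>R (rm - r (t (Suc i)) - p (t i))"
        by (simp add: w_def p_def upd int scaleR_diff_right)
    qed
  qed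
  then obtain em wm pm where
    lim: "\<And>i. (e \<longlongrightarrow> em i) (at_left (t (Suc i)))" "\<And>i. (w \<longlongrightarrow> wm i) (at_left (t (Suc i)))"
      "\<And>i. (p \<longlongrightarrow> pm i) (at_left (t (Suc i)))"
    and upd: "\<And>i. e (t (Suc i)) = F1 (Suc i) *v em i"
      "\<And>i. w (t (Suc i)) = wm i - (1 / (t (Suc i) - t i)) *\<^sub>R (pm i - p (t i))"
      "\<And>i. p (t (Suc i)) = F3 (Suc i) *v pm i"
    by metis

  \<comment> \<open>Decay of the attitude error\<close>
  have e_const: "norm (e s) = norm (e (t i))" if "s \<in> ?I i" for s i
    by (rule norm_constant_if_velocity_orthogonal[OF _ e_deriv])
      (use that gap_pos[of i] in \<open>auto simp: inner_Omega_eq_0\<close>)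
  have em: "norm (em i) = norm (e (t i))" for i
  proof -
    have "((\<lambda>s. norm (e s)) \<longlongrightarrow> norm (em i)) (at_left (t (Suc i)))" by (intro tendsto_intros lim)
    moreover have "((\<lambda>s. norm (e s)) \<longlongrightarrow> norm (e (t i))) (at_left (t (Suc i)))"
      by (rule tendsto_eventually, rule eventually_mono[OF eventually_at_left_real[OF gap_pos]],
          rule e_const) auto
    ultimately show ?thesis by (rule tendsto_unique[OF trivial_limit_at_left_real])
  qed
  define E where "E = norm (e (t 0))"
  have E: "E \<ge> 0" by (simp add: E_def)
  have e_inst: "norm (e (t i)) \<le> E * a ^ i" for i
  proof (induction i)
    case (Suc i)
    have "norm (e (t (Suc i))) \<le> a * norm (e (t i))" using F1[of "Suc i" "em i"] by (simp add: upd em)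
    also have "\<dots> \<le> a * (E * a ^ i)" using Suc a by (intro mult_left_mono) auto
    finally show ?case by (simp add: mult_ac)
  qed (simp add: E_def)
  have e_bound: "norm (e s) \<le> E * a ^ i" if "s \<in> ?I i" for s i
    using e_const[OF that] e_inst[of i] by simp

  \<comment> \<open>Decay of the velocity error\<close>
  define Q where "Q = norm (q (t 0))"
  have Q: "norm (q s) = Q" if "s \<ge> t 0" for s
    unfolding Q_def by (rule norm_constant_if_velocity_orthogonal[where S = "{t 0..}", OF _ sys(1)])
      (use that in \<open>auto simp: inner_Omega_eq_0\<close>)
  \<comment> \<open>Here \<open>norm (qh s) \<le> E + Q\<close>, so \<open>E + 2 * Q\<close> bounds
    the sum of the two quaternion norms in the Lipschitz estimate for \<open>rot_mat\<close>, and
    \<open>G\<close> bounds the acceleration.\<close>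
  define C where "C = 36 * (E * (E + 2 * Q)) * G"
  have C: "C \<ge> 0" using E \<open>G > 0\<close> by (simp add: C_def Q_def)
  have w'_bound: "norm (w' s) \<le> C * a ^ i" if "s \<in> ?I i" for s i
  proof -
    have s: "s \<ge> t 0" using that t0[of i] by auto
    have "norm (e s) \<le> E * 1"
      using e_bound[OF that] E a by (elim order_trans) (intro mult_left_mono power_le_one; simp)
    moreover have "norm (qh s) \<le> norm (e s) + norm (q s)"
      using norm_triangle_ineq[of "e s" "q s"] by (simp add: e_def)
    ultimately have "norm (qh s) + norm (q s) \<le> E + 2 * Q" using Q[OF s] by simp
    moreover have "norm (qh s - q s) \<le> E * a ^ i" using e_bound[OF that] by (simp add: e_def)
    ultimately have "36 * (norm (qh s - q s) * (norm (qh s) + norm (q s))) * norm (\<gamma> s)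
        \<le> 36 * ((E * a ^ i) * (E + 2 * Q)) * G"
      using G[OF s] E a by (intro mult_mono) (auto simp: Q_def)
    then show ?thesis
      using norm_rot_mat_diff_le[of "qh s" "\<gamma> s" "q s"] by (simp add: w'_def C_def mult_ac)
  qed
  \<comment> \<open>No earlier velocity error enters the bound: subtracting the mean leaves only
    what the derivative of \<open>w\<close> produced over the last interval.\<close>
  have w_upd: "norm (w (t (Suc i))) \<le> C * a ^ i * T" for i
  proof -
    have "norm (w (t (Suc i))) \<le> C * a ^ i * (t (Suc i) - t i)"
      unfolding upd
      by (rule left_limit_minus_mean_le[OF gap_pos p_deriv w_deriv w'_bound lim(3,2)]) auto
    also have "\<dots> \<le> C * a ^ i * T" using gaps C a by (intro mult_left_mono) auto
    finally show ?thesis .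
  qed
  \<comment> \<open>The first summand serves \<open>i = 0\<close>, before any update. The second is
    the bound after an update, where \<open>1 / a\<close> turns \<open>a ^ j\<close> into
    \<open>a ^ Suc j\<close>. The third is the growth within an interval.\<close>
  define W where "W = norm (w (t 0)) + C * T / a + C * T"
  have W: "W \<ge> 0" using C T a by (simp add: W_def)
  have w_bound: "norm (w s) \<le> W * a ^ i" if s: "s \<in> ?I i" for s i
  proof -
    have "norm (w s - w (t i)) \<le> C * a ^ i * (s - t i)"
      by (rule norm_increment_le[OF w_deriv w'_bound]) (use s in auto)
    also have "\<dots> \<le> C * a ^ i * T" using s gaps[of i] C a by (intro mult_left_mono) auto
    finally have "norm (w s - w (t i)) \<le> C * T * a ^ i" by (simp add: mult_ac)
    moreover have "norm (w (t i)) \<le> (norm (w (t 0)) + C * T / a) * a ^ i"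
    proof (cases i)
      case 0
      then show ?thesis using C T a by simp
    next
      case (Suc j)
      have "norm (w (t i)) \<le> C * T / a * a ^ i"
        using w_upd[of j] a by (simp add: Suc mult_ac)
      also have "\<dots> \<le> (norm (w (t 0)) + C * T / a) * a ^ i"
        using a by (intro mult_right_mono) auto
      finally show ?thesis .
    qed
    ultimately have "norm (w s) \<le> (norm (w (t 0)) + C * T / a) * a ^ i + C * T * a ^ i"
      using norm_triangle_sub[of "w s" "w (t i)"] by linarith
    then show ?thesis by (simp add: W_def algebra_simps)
  qed

  \<comment> \<open>Decay of the position error\<close>
  \<comment> \<open>The velocity error forces the position recursion at the contraction rate
    \<open>a\<close> itself, so a slower rate is needed; the midpoint of \<open>a\<close> and 1 is
    one choice.\<close>
  define b where "b = (1 + a) / 2"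
  have b: "0 < b" "b < 1" "a < b" using a by (auto simp: b_def)
  define P where "P = norm (p (t 0)) + a * (W * T) / (b - a)"
  have p_inst: "norm (p (t i)) \<le> P * b ^ i" for i
  proof -
    have "norm (p (t i)) \<le> (\<bar>norm (p (t 0))\<bar> + a * (W * T) / (b - a)) * b ^ i"
    proof (rule contractive_recursion_bound)
      fix i
      \<comment> \<open>Over the interval the velocity error moves \<open>p\<close> by at most
        \<open>W * T * a ^ i\<close>; only then does \<open>F3\<close> contract the result.\<close>
      have "norm (pm i - p (t i)) \<le> W * a ^ i * (t (Suc i) - t i)"
        by (rule norm_increment_left_limit_le[OF p_deriv w_bound lim(3)]) (use gap_pos[of i] in auto)
      also have "\<dots> \<le> W * a ^ i * T" using gaps W a by (intro mult_left_mono) auto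
      finally have "norm (pm i) \<le> norm (p (t i)) + W * T * a ^ i"
        using norm_triangle_sub[of "pm i" "p (t i)"] by (simp add: mult_ac)
      then have "a * norm (pm i) \<le> a * (norm (p (t i)) + W * T * a ^ i)"
        using a by (intro mult_left_mono) auto
      then show "norm (p (t (Suc i))) \<le> a * (norm (p (t i)) + W * T * a ^ i)"
        unfolding upd using F3[of "Suc i" "pm i"] by linarith
    qed (use a b W T in auto)
    then show ?thesis by (simp add: P_def)
  qed
  have p_bound: "norm (p s) \<le> (P + W * T) * b ^ i" if s: "s \<in> ?I i" for s i
  proof -
    have "norm (p s - p (t i)) \<le> W * a ^ i * (s - t i)"
      by (rule norm_increment_le[OF p_deriv w_bound]) (use s in auto)
    also have "\<dots> \<le> W * b ^ i * T"
      using s gaps[of i] W a b by (intro mult_mono power_mono) auto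
    finally show ?thesis
      using p_inst[of i] norm_triangle_sub[of "p s" "p (t i)"] by (simp add: algebra_simps)
  qed

  \<comment> \<open>Exponential convergence of the three estimates\<close>
  have "tends_exponentially (t 0) qh q"
    by (rule tends_exponentially_if_geometric[where t = t and T = T and b = a and K = E and xh = qh and x = q,
        OF instants(2) gaps T a _ E])
      (use e_bound in \<open>auto simp: e_def\<close>)
  moreover have "tends_exponentially (t 0) vh v"
    by (rule tends_exponentially_if_geometric[where t = t and T = T and b = a and K = W and xh = vh and x = v,
        OF instants(2) gaps T a _ W])
      (use w_bound in \<open>auto simp: w_def\<close>)
  moreover have "tends_exponentially (t 0) rh r"
  proof (rule tends_exponentially_if_geometric[where t = t and T = T and xh = rh and x = r and b = b and K = "P + W * T",
        OF instants(2) gaps T b(1,2)])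
    show "P + W * T \<ge> 0" using a b W T by (simp add: P_def)
  qed (use p_bound in \<open>auto simp: p_def\<close>)
  ultimately show ?thesis by blast
qed

end
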